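(* Let $G=(V,E)$ be an infinite, connected, locally finite, simple undirected graph with girth at least $6$ and with $D:=\sup_{x\in V}d_x<\infty$. Let $\kappa^*:E\to\mathbb{R}$ be such that there is $r^*\in\ell^\infty(E)$ with $\kappa(r^* )=\kappa^*$. Let $r(0):E\to\mathbb{R}$ satisfy $r(0)-r^*\in\ell^2(E)$ and $$\|r(0)-r^*\|_\infty\le 3\sqrt3\,\min\left\{1,\left(De^{2\|r^*\|_\infty}\right)^{-2}\right\}.$$ Then the solution $r(t)$ of the Ricci flow $$\frac{d}{dt}r(t,e)=-\kappa_e(r(t))+\kappa^*(e),\qquad t>0,\ e\in E,$$ with initial value $r(0)$ converges to $r^*$ as $t\to\infty$, i.e. $r(t,e)\to r^*_e$ for every $e\in E$. Moreover, the curvature converges to $\kappa^*$, i.e. $\kappa_e(r(t))\to\kappa^*(e)$ for every $e\in E$ as $t\to\infty$.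
   Context: $d_x$ is the number of neighbours of $x$. The girth is the length of a shortest cycle ($\infty$ if there is none). For $r:E\to\mathbb{R}$ (so that $\omega=e^{r}$ is a positive edge weight) the Lin-Lu-Yau curvature of an edge $e=(x,y)$ on a graph of girth at least $6$ is $\kappa_e(r)=2\left(\frac{e^{r_{xy}}}{m(x)}+\frac{e^{r_{xy}}}{m(y)}\right)-2$, where $m(x)=\sum_{u\sim x}e^{r_{xu}}$; $\kappa(r)$ denotes the function $e\mapsto\kappa_e(r)$ on $E$. $\ell^p(E)$ are the usual spaces of $p$-summable (bounded, if $p=\infty$) real functions on $E$, and $\|\cdot\|_\infty$ is the supremum norm on $E$. A solution is a family of functions $r(\cdot,e)$, continuous on $[0,\infty)$, satisfying the equation for $t>0$ and the initial condition; on graphs of girth at least $6$ the flow has exactly one solution, defined for all $t\ge0$, for every initial value. *)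

theory Defs
  imports "HOL-Analysis.Analysis" "HOL-Library.Extended_Nat"
begin

text \<open>
  Undirected simple graphs are given by a vertex set and a set of two-element edges.
  A real function on the edges is a total function on \<^typ>\<open>'a set\<close> of which
  only the values on the edge set matter.
\<close>

definition simple_graph :: "'a set \<Rightarrow> 'a set set \<Rightarrow> bool" where
  "simple_graph V E \<longleftrightarrow> (\<forall>e\<in>E. e \<subseteq> V \<and> card e = 2)"

definition neighbours :: "'a set set \<Rightarrow> 'a \<Rightarrow> 'a set" where
  "neighbours E x = {u. {x, u} \<in> E}"

definition degree :: "'a set set \<Rightarrow> 'a \<Rightarrow> nat" where
  "degree E x = card (neighbours E x)"

definition locally_finite_graph :: "'a set \<Rightarrow> 'a set set \<Rightarrow> bool" where
  "locally_finite_graph V E \<longleftrightarrow> (\<forall>x\<in>V. finite (neighbours E x))"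

definition connected_graph :: "'a set \<Rightarrow> 'a set set \<Rightarrow> bool" where
  "connected_graph V E \<longleftrightarrow> (\<forall>x\<in>V. \<forall>y\<in>V. (x, y) \<in> {(u, v). {u, v} \<in> E}\<^sup>*)"

text \<open>
  The supremum is taken in \<^typ>\<open>nat\<close>, so it is meaningful only for a nonempty
  vertex set and under \<^const>\<open>bdd_above\<close>.
\<close>

definition max_degree :: "'a set \<Rightarrow> 'a set set \<Rightarrow> nat" where
  "max_degree V E = (SUP x\<in>V. degree E x)"

definition is_cycle :: "'a set set \<Rightarrow> 'a list \<Rightarrow> bool" where
  "is_cycle E c \<longleftrightarrow> length c \<ge> 3 \<and> distinct c \<and>
     (\<forall>i<length c. {c ! i, c ! (Suc i mod length c)} \<in> E)"

text \<open>The infimum of the empty set in \<^typ>\<open>enat\<close> is \<open>\<infinity>\<close>.\<close>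

definition girth :: "'a set set \<Rightarrow> enat" where
  "girth E = (INF c\<in>{c. is_cycle E c}. enat (length c))"

definition vertex_weight :: "'a set set \<Rightarrow> ('a set \<Rightarrow> real) \<Rightarrow> 'a \<Rightarrow> real" where
  "vertex_weight E r x = (\<Sum>u\<in>neighbours E x. exp (r {x, u}))"

text \<open>
  Lin-Lu-Yau curvature for the edge weight \<open>exp \<circ> r\<close>; this closed form is valid
  on graphs of girth at least 6.  The sum runs over the two endpoints of the edge.
\<close>

definition LLY_curvature :: "'a set set \<Rightarrow> ('a set \<Rightarrow> real) \<Rightarrow> 'a set \<Rightarrow> real" where
  "LLY_curvature E r e = 2 * (\<Sum>x\<in>e. exp (r e) / vertex_weight E r x) - 2"

lemma LLY_curvature_edge:
  assumes "x \<noteq> y"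
  shows "LLY_curvature E r {x, y} =
    2 * (exp (r {x, y}) / vertex_weight E r x + exp (r {x, y}) / vertex_weight E r y) - 2"
  using assms by (simp add: LLY_curvature_def)

definition ell2 :: "'b set \<Rightarrow> ('b \<Rightarrow> real) set" where
  "ell2 E = {f. (\<lambda>e. \<bar>f e\<bar>\<^sup>2) summable_on E}"

definition ell_infinity :: "'b set \<Rightarrow> ('b \<Rightarrow> real) set" where
  "ell_infinity E = {f. bounded (f ` E)}"

text \<open>Meaningful only for bounded functions on a nonempty set.\<close>

definition sup_norm :: "'b set \<Rightarrow> ('b \<Rightarrow> real) \<Rightarrow> real" where
  "sup_norm E f = (SUP e\<in>E. \<bar>f e\<bar>)"

definition ricci_flow_solution ::
    "'a set set \<Rightarrow> ('a set \<Rightarrow> real) \<Rightarrow> ('a set \<Rightarrow> real) \<Rightarrow> (real \<Rightarrow> 'a set \<Rightarrow> real) \<Rightarrow> bool" where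
  "ricci_flow_solution E \<kappa>s r0 r \<longleftrightarrow>
     (\<forall>e\<in>E. continuous_on {0..} (\<lambda>t. r t e) \<and> r 0 e = r0 e \<and>
       (\<forall>t>0. ((\<lambda>s. r s e) has_real_derivative (- LLY_curvature E (r t) e + \<kappa>s e)) (at t)))"

end

theory Submission
  imports Defs
begin

text \<open>
  With \<open>f = r - r\<^sup>*\<close>, the flow is \<open>f' = - 2 \<Sum>\<^sub>x (p\<^sub>x(r) - p\<^sub>x(r\<^sup>*))\<close>, summed over the endpoints of the
  edge, where \<open>p\<^sub>x\<close>, the softmax on the edges at \<open>x\<close>, is a monotone map.  Hence the \<open>\<ell>\<^sup>2\<close> norm of
  \<open>f\<close> does not increase, and it drops at a definite rate while \<open>f\<close> differs on two adjacent edges.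
  As \<open>f\<close> is Lipschitz in time, these differences tend to \<open>0\<close>; by connectedness so does
  \<open>f\<^sub>e - f\<^sub>e\<^sub>'\<close> for all edges, and since there are infinitely many edges and the \<open>\<ell>\<^sup>2\<close> norm is
  bounded, \<open>f\<close> itself tends to \<open>0\<close>.  That \<open>f(t)\<close> stays in \<open>\<ell>\<^sup>2\<close> is not part of the notion of
  solution and is obtained from energies on finite edge sets.
\<close>

subsection \<open>Monotonicity of the softmax map\<close>

definition gibbs :: "'b set \<Rightarrow> ('b \<Rightarrow> real) \<Rightarrow> 'b \<Rightarrow> real" where
  "gibbs A r a = exp (r a) / (\<Sum>b\<in>A. exp (r b))"

lemma sum_exp_pos:
  fixes r :: "'b \<Rightarrow> real"
  assumes "finite A" "a \<in> A"
  shows "0 < (\<Sum>b\<in>A. exp (r b))"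
  using assms by (intro sum_pos) auto

lemma gibbs_pos: "finite A \<Longrightarrow> a \<in> A \<Longrightarrow> 0 < gibbs A r a"
  by (simp add: gibbs_def sum_exp_pos)

lemma gibbs_le_1: "finite A \<Longrightarrow> a \<in> A \<Longrightarrow> gibbs A r a \<le> 1"
  using sum_exp_pos[of A a r] member_le_sum[of a A "\<lambda>b. exp (r b)"]
  by (simp add: gibbs_def)

lemma sum_exp_le:
  fixes r s :: "'b \<Rightarrow> real"
  assumes "\<And>b. b \<in> A \<Longrightarrow> \<bar>r b - s b\<bar> \<le> M"
  shows "(\<Sum>b\<in>A. exp (r b)) \<le> exp M * (\<Sum>b\<in>A. exp (s b))"
  unfolding sum_distrib_left
proof (rule sum_mono)
  fix b assume "b \<in> A"
  with assms[of b] show "exp (r b) \<le> exp M * exp (s b)"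
    by (simp flip: exp_add)
qed

text \<open>Numerator and denominator each change by a factor of at most \<open>exp M\<close>, so
  the softmax changes by at most \<open>exp (2 * M)\<close>. As it is at most 1 and
  \<open>1 - 2 * M \<le> exp (- 2 * M)\<close>, this becomes a linear bound for every
  \<open>M\<close>.\<close>

lemma gibbs_diff_le_one_sided:
  assumes A: "finite A" "a \<in> A" and M: "\<And>b. b \<in> A \<Longrightarrow> \<bar>r b - s b\<bar> \<le> M"
  shows "gibbs A r a - gibbs A s a \<le> 2 * M"
proof -
  define P where "P = (\<Sum>b\<in>A. exp (r b))"
  define Q where "Q = (\<Sum>b\<in>A. exp (s b))"
  have pos: "0 < P" "0 < Q"
    using A by (auto simp: P_def Q_def intro: sum_exp_pos)
  have "exp (r a) * exp (- 2 * M) * Q = exp (r a - M) * (exp (- M) * Q)"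
    by (simp add: exp_diff exp_minus field_simps flip: exp_add)
  also have "\<dots> \<le> exp (s a) * P"
  proof (intro mult_mono)
    show "exp (r a - M) \<le> exp (s a)" using M[OF A(2)] by simp
    have "Q \<le> exp M * P"
      unfolding P_def Q_def using M by (intro sum_exp_le) (simp add: abs_minus_commute)
    then show "exp (- M) * Q \<le> P" by (simp add: exp_minus field_simps)
  qed (use pos in auto)
  finally have *: "gibbs A r a * exp (- 2 * M) \<le> gibbs A s a"
    using pos by (simp add: gibbs_def P_def[symmetric] Q_def[symmetric] field_simps)
  have M0: "0 \<le> M" using M[OF A(2)] by linarith
  have "gibbs A r a * (1 - 2 * M) \<le> gibbs A r a * exp (- 2 * M)"
    using gibbs_pos[OF A, of r] exp_ge_add_one_self[of "- 2 * M"] by (intro mult_left_mono) auto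
  with * have "gibbs A r a - gibbs A s a \<le> gibbs A r a * (2 * M)"
    by (simp add: algebra_simps)
  also have "\<dots> \<le> 1 * (2 * M)"
    using gibbs_le_1[OF A, of r] M0 by (intro mult_right_mono) auto
  finally show ?thesis by simp
qed

lemma gibbs_diff_le:
  assumes "finite A" "a \<in> A"
  shows "\<bar>gibbs A r a - gibbs A s a\<bar> \<le> 2 * (\<Sum>b\<in>A. \<bar>r b - s b\<bar>)"
proof -
  define M where "M = (\<Sum>b\<in>A. \<bar>r b - s b\<bar>)"
  have M: "\<bar>r b - s b\<bar> \<le> M" if "b \<in> A" for b
    unfolding M_def using assms that by (intro member_le_sum) auto
  have "gibbs A r a - gibbs A s a \<le> 2 * M" "gibbs A s a - gibbs A r a \<le> 2 * M"
    using M by (auto intro!: gibbs_diff_le_one_sided[OF assms] simp: abs_minus_commute)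
  then show ?thesis by (simp add: M_def abs_le_iff)
qed

text \<open>
  Monotonicity of \<^const>\<open>gibbs\<close> becomes explicit in the Chebyshev double sum, whose terms are
  all nonnegative.
\<close>

lemma gibbs_pairing:
  fixes r s :: "'b \<Rightarrow> real"
  assumes A: "finite A" "a \<in> A"
  defines "h \<equiv> \<lambda>b. r b - s b"
  shows "(\<Sum>c\<in>A. h c * (gibbs A r c - gibbs A s c)) =
    (\<Sum>c\<in>A. \<Sum>c'\<in>A. exp (s c) * exp (s c') * ((h c - h c') * (exp (h c) - exp (h c'))))
      / (2 * (\<Sum>b\<in>A. exp (r b)) * (\<Sum>b\<in>A. exp (s b)))"
proof -
  define P where "P = (\<Sum>b\<in>A. exp (r b))"
  define Q where "Q = (\<Sum>b\<in>A. exp (s b))"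
  have pos: "0 < P" "0 < Q"
    using A by (auto simp: P_def Q_def intro: sum_exp_pos)
  define S where "S = (\<Sum>c\<in>A. \<Sum>c'\<in>A. h c * (exp (r c) * exp (s c') - exp (s c) * exp (r c')))"
  have r: "exp (r c) = exp (s c) * exp (h c)" for c
    by (simp add: h_def flip: exp_add)
  have "(\<Sum>c\<in>A. h c * (gibbs A r c - gibbs A s c)) =
      (\<Sum>c\<in>A. h c * (exp (r c) * Q - exp (s c) * P)) / (P * Q)"
    using pos by (simp add: gibbs_def sum_divide_distrib field_simps flip: P_def Q_def)
  also have "(\<Sum>c\<in>A. h c * (exp (r c) * Q - exp (s c) * P)) = S"
    unfolding S_def P_def Q_def
    by (simp add: sum_distrib_left sum_subtractf right_diff_distrib mult.assoc)
  finally have 1: "(\<Sum>c\<in>A. h c * (gibbs A r c - gibbs A s c)) = S / (P * Q)" .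
  \<comment> \<open>The bracket in \<open>S\<close> is antisymmetric in \<open>c\<close> and
    \<open>c'\<close>, so adding the copy with exchanged variables turns \<open>h c\<close> into
    \<open>h c - h c'\<close>.\<close>
  have "S = (\<Sum>c\<in>A. \<Sum>c'\<in>A. h c' * (exp (r c') * exp (s c) - exp (s c') * exp (r c)))"
    unfolding S_def by (rule sum.swap)
  then have "2 * S = (\<Sum>c\<in>A. \<Sum>c'\<in>A. exp (s c) * exp (s c') * ((h c - h c') * (exp (h c) - exp (h c'))))"
    unfolding mult_2 by (subst (1) S_def) (simp add: r algebra_simps flip: sum.distrib)
  then show ?thesis
    using 1 pos by (simp add: field_simps flip: P_def Q_def)
qed

lemma diff_exp_diff_nonneg: "0 \<le> (x - y) * (exp x - exp (y::real))"
  by (cases x y rule: linorder_cases) (auto intro: mult_nonneg_nonneg mult_nonpos_nonpos)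

text \<open>Quantitative monotonicity: the slope of \<open>exp\<close> is at least
  \<open>exp (- M)\<close> to the right of \<open>- M\<close>.\<close>

lemma diff_exp_diff_ge:
  fixes x y :: real
  assumes "- M \<le> x" "- M \<le> y"
  shows "exp (- M) * (x - y)\<^sup>2 \<le> (x - y) * (exp x - exp y)"
proof -
  have *: "exp (- M) * (x - y)\<^sup>2 \<le> (x - y) * (exp x - exp y)" if "- M \<le> y" "y \<le> x" for x y :: real
  proof -
    have "exp (- M) * (x - y) \<le> exp y * (exp (x - y) - 1)"
    proof (rule mult_mono)
      show "x - y \<le> exp (x - y) - 1"
        using exp_ge_add_one_self[of "x - y"] by linarith
    qed (use that in auto)
    also have "\<dots> = exp x - exp y" by (simp add: exp_diff field_simps)
    finally have "(x - y) * (exp (- M) * (x - y)) \<le> (x - y) * (exp x - exp y)"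
      using that by (intro mult_left_mono) auto
    then show ?thesis by (simp add: power2_eq_square algebra_simps)
  qed
  show ?thesis
    using *[of y x] *[of x y] assms
    by (cases "y \<le> x") (auto simp: power2_commute algebra_simps)
qed

lemma gibbs_pairing_nonneg:
  assumes "finite A"
  shows "0 \<le> (\<Sum>c\<in>A. (r c - s c) * (gibbs A r c - gibbs A s c))"
proof (cases "A = {}")
  case False
  then obtain a where "a \<in> A" by blast
  then show ?thesis
    unfolding gibbs_pairing[OF assms \<open>a \<in> A\<close>]
    by (intro divide_nonneg_nonneg sum_nonneg mult_nonneg_nonneg diff_exp_diff_nonneg) auto
qed simp

text \<open>Only the term \<open>(a, b)\<close> of the double sum is kept. One factor
  \<open>exp (- M)\<close> comes from the slope of \<open>exp\<close>, the other from comparing the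
  normalisations of \<open>r\<close> and \<open>s\<close>. The constant involves only
  \<open>s\<close> and \<open>M\<close>, so along the flow it is uniform in time once
  \<open>M\<close> is.\<close>

lemma gibbs_pairing_ge:
  assumes A: "finite A" "a \<in> A" "b \<in> A" and M: "\<And>c. c \<in> A \<Longrightarrow> \<bar>r c - s c\<bar> \<le> M"
  shows "gibbs A s a * gibbs A s b * exp (- 2 * M) / 2 * ((r a - s a) - (r b - s b))\<^sup>2
    \<le> (\<Sum>c\<in>A. (r c - s c) * (gibbs A r c - gibbs A s c))"
proof -
  define P where "P = (\<Sum>b\<in>A. exp (r b))"
  define Q where "Q = (\<Sum>b\<in>A. exp (s b))"
  define h where "h c = r c - s c" for c
  define W where "W c c' = exp (s c) * exp (s c') * ((h c - h c') * (exp (h c) - exp (h c')))" for c c'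
  have pos: "0 < P" "0 < Q"
    using A by (auto simp: P_def Q_def intro: sum_exp_pos)
  have W0: "0 \<le> W c c'" for c c'
    unfolding W_def by (intro mult_nonneg_nonneg diff_exp_diff_nonneg) auto
  have "exp (s a) * exp (s b) * (exp (- M) * (h a - h b)\<^sup>2) \<le> W a b"
    unfolding W_def using M[OF A(2)] M[OF A(3)]
    by (intro mult_left_mono diff_exp_diff_ge) (auto simp: h_def abs_le_iff)
  also have "W a b \<le> (\<Sum>c'\<in>A. W a c')"
    using A W0 by (intro member_le_sum) auto
  also have "\<dots> \<le> (\<Sum>c\<in>A. \<Sum>c'\<in>A. W c c')"
    using A W0 by (intro member_le_sum[where f = "\<lambda>c. \<Sum>c'\<in>A. W c c'"]) (auto intro: sum_nonneg)
  finally have 1: "exp (s a) * exp (s b) * (exp (- M) * (h a - h b)\<^sup>2) / (2 * P * Q)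
      \<le> (\<Sum>c\<in>A. (r c - s c) * (gibbs A r c - gibbs A s c))"
    unfolding gibbs_pairing[OF A(1,2)] using pos
    by (auto intro!: divide_right_mono simp: W_def h_def P_def Q_def)
  have "P \<le> exp M * Q"
    unfolding P_def Q_def using M by (intro sum_exp_le)
  then have "exp (s a) * exp (s b) * (exp (- M) * (h a - h b)\<^sup>2) / (2 * (exp M * Q) * Q)
      \<le> exp (s a) * exp (s b) * (exp (- M) * (h a - h b)\<^sup>2) / (2 * P * Q)"
    using pos by (intro divide_left_mono mult_right_mono mult_left_mono) auto
  also note 1
  also have "exp (s a) * exp (s b) * (exp (- M) * (h a - h b)\<^sup>2) / (2 * (exp M * Q) * Q) =
      gibbs A s a * gibbs A s b * exp (- 2 * M) / 2 * (h a - h b)\<^sup>2"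
    using pos exp_add[of M M] by (simp add: gibbs_def exp_minus field_simps flip: Q_def)
  finally show ?thesis by (simp add: h_def)
qed


text \<open>Derivatives are required only inside the interval because a solution is only assumed
  continuous at time 0.\<close>

lemma increment_le_of_derivative_le:
  fixes g h :: "real \<Rightarrow> real"
  assumes "s \<le> t" "continuous_on {s..t} g" "continuous_on {s..t} h"
    and "\<And>x. s < x \<Longrightarrow> x < t \<Longrightarrow> (g has_real_derivative g' x) (at x)"
    and "\<And>x. s < x \<Longrightarrow> x < t \<Longrightarrow> (h has_real_derivative h' x) (at x)"
    and "\<And>x. s < x \<Longrightarrow> x < t \<Longrightarrow> g' x \<le> h' x"
  shows "g t - g s \<le> h t - h s"
proof -
  have "g t - h t \<le> g s - h s"
  proof (rule DERIV_nonpos_imp_decreasing_open[of s t "\<lambda>x. g x - h x"])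
    fix x assume x: "s < x" "x < t"
    show "\<exists>y. ((\<lambda>x. g x - h x) has_real_derivative y) (at x) \<and> y \<le> 0"
      using DERIV_diff[OF assms(4,5)[OF x]] assms(6)[OF x] by (intro exI[of _ "g' x - h' x"]) auto
  qed (use assms in \<open>auto intro: continuous_intros\<close>)
  then show ?thesis by simp
qed

subsection \<open>Energy along the flow\<close>

definition incident :: "'a set set \<Rightarrow> 'a \<Rightarrow> 'a set set" where
  "incident E x = {e\<in>E. x \<in> e}"

text \<open>The prescribed curvature enters as the curvature of \<open>rs\<close>: the additive
  constants cancel and each endpoint contributes a difference of softmax values.\<close>

locale bounded_degree_flow =
  fixes E :: "'a set set" and D :: nat and rs :: "'a set \<Rightarrow> real"
    and r :: "real \<Rightarrow> 'a set \<Rightarrow> real"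
  assumes card_edge: "e \<in> E \<Longrightarrow> card e = 2"
    and finite_incident: "finite (incident E x)"
    and card_incident: "card (incident E x) \<le> D"
    and continuous: "e \<in> E \<Longrightarrow> continuous_on {0..} (\<lambda>t. r t e)"
    and derivative: "e \<in> E \<Longrightarrow> 0 < t \<Longrightarrow> ((\<lambda>t. r t e) has_real_derivative
      - 2 * (\<Sum>x\<in>e. gibbs (incident E x) (r t) e - gibbs (incident E x) rs e)) (at t)"
begin

definition dev :: "real \<Rightarrow> 'a set \<Rightarrow> real" where
  "dev t e = r t e - rs e"

definition force :: "real \<Rightarrow> 'a \<Rightarrow> 'a set \<Rightarrow> real" where
  "force t x e = gibbs (incident E x) (r t) e - gibbs (incident E x) rs e"

definition dissipation :: "real \<Rightarrow> 'a \<Rightarrow> real" where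
  "dissipation t x = (\<Sum>e\<in>incident E x. dev t e * force t x e)"

definition energy :: "real \<Rightarrow> 'a set set \<Rightarrow> real" where
  "energy t B = (\<Sum>e\<in>B. (dev t e)\<^sup>2)"

definition nbhd :: "'a set set \<Rightarrow> 'a set set" where
  "nbhd B = (\<Union>x\<in>\<Union>B. incident E x)"

text \<open>Bounds the squared \<open>\<ell>\<^sup>2\<close> norm through finite partial sums, which
  makes sense before summability at time \<open>t\<close> is known.\<close>

definition energy_le :: "real \<Rightarrow> real \<Rightarrow> bool" where
  "energy_le t A \<longleftrightarrow> (\<forall>F\<subseteq>E. finite F \<longrightarrow> energy t F \<le> A)"

lemma finite_edge: "e \<in> E \<Longrightarrow> finite e"
  using card_edge[of e] card.infinite by fastforce

lemma finite_Union: "B \<subseteq> E \<Longrightarrow> finite B \<Longrightarrow> finite (\<Union>B)"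
  using finite_edge by auto

lemma nbhd_subset: "nbhd B \<subseteq> E"
  by (auto simp: nbhd_def incident_def)

lemma finite_nbhd: "B \<subseteq> E \<Longrightarrow> finite B \<Longrightarrow> finite (nbhd B)"
  unfolding nbhd_def using finite_Union finite_incident by blast

lemma subset_nbhd: "B \<subseteq> E \<Longrightarrow> B \<subseteq> nbhd B"
proof
  fix e assume "B \<subseteq> E" "e \<in> B"
  moreover from this obtain x where "x \<in> e"
    using card_edge[of e] by fastforce
  ultimately show "e \<in> nbhd B" by (auto simp: nbhd_def incident_def)
qed

text \<open>An edge has two endpoints with at most \<open>D\<close> edges each. Iterated
  neighbourhoods thus grow at most exponentially, which a factorial later outweighs.\<close>

lemma card_nbhd:
  assumes "B \<subseteq> E" "finite B"
  shows "card (nbhd B) \<le> 2 * D * card B"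
proof -
  have "card (\<Union>B) \<le> (\<Sum>e\<in>B. card e)"
    by (rule card_Union_le_sum_card)
  also have "\<dots> = 2 * card B"
    using assms card_edge by (subst sum.cong[of B B card "\<lambda>_. 2"]) auto
  finally have 1: "card (\<Union>B) \<le> 2 * card B" .
  have "card (nbhd B) \<le> (\<Sum>x\<in>\<Union>B. card (incident E x))"
    unfolding nbhd_def using finite_Union[OF assms] by (rule card_UN_le)
  also have "\<dots> \<le> card (\<Union>B) * D"
    using sum_bounded_above[of "\<Union>B" "\<lambda>x. card (incident E x)" D] card_incident by simp
  also have "\<dots> \<le> 2 * card B * D"
    using 1 by (intro mult_right_mono) auto
  finally show ?thesis by (simp add: mult_ac)
qed

lemma dissipation_nonneg: "0 \<le> dissipation t x"
  unfolding dissipation_def force_def dev_def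
  by (rule gibbs_pairing_nonneg[OF finite_incident])

lemma energy_nonneg: "0 \<le> energy t B"
  by (simp add: energy_def sum_nonneg)

lemma energy_mono: "finite C \<Longrightarrow> B \<subseteq> C \<Longrightarrow> energy t B \<le> energy t C"
  unfolding energy_def by (rule sum_mono2) auto

lemma dev_derivative:
  assumes "e \<in> E" "0 < t"
  shows "((\<lambda>t. dev t e) has_real_derivative - 2 * (\<Sum>x\<in>e. force t x e)) (at t)"
  unfolding dev_def force_def
  by (rule derivative_eq_intros derivative[OF assms] refl)+ simp

lemma dev_continuous: "e \<in> E \<Longrightarrow> continuous_on {0..} (\<lambda>t. dev t e)"
  unfolding dev_def by (intro continuous_intros continuous)

lemma energy_continuous: "B \<subseteq> E \<Longrightarrow> continuous_on {0..} (\<lambda>t. energy t B)"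
  unfolding energy_def by (intro continuous_intros dev_continuous) auto

lemma abs_force_le_1:
  assumes "e \<in> E" "x \<in> e"
  shows "\<bar>force t x e\<bar> \<le> 1"
proof -
  have "e \<in> incident E x" using assms by (simp add: incident_def)
  note b = gibbs_pos[OF finite_incident this] gibbs_le_1[OF finite_incident this]
  show ?thesis
    unfolding force_def using b[of rs] b[of "r t"] by (simp add: abs_le_iff)
qed

lemma abs_dev_derivative_le:
  assumes "e \<in> E"
  shows "\<bar>- 2 * (\<Sum>x\<in>e. force t x e)\<bar> \<le> 4"
proof -
  have "\<bar>\<Sum>x\<in>e. force t x e\<bar> \<le> (\<Sum>x\<in>e. \<bar>force t x e\<bar>)" by (rule sum_abs)
  also have "\<dots> \<le> of_nat (card e) * 1"
    using assms abs_force_le_1 by (intro sum_bounded_above) auto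
  finally show ?thesis using card_edge[OF assms] by simp
qed

text \<open>The speed limit 4 is the factor 2 of the flow times two endpoints, each with a force of
  size at most 1.\<close>

lemma dev_lipschitz:
  assumes e: "e \<in> E" and st: "0 \<le> s" "s \<le> t"
  shows "\<bar>dev t e - dev s e\<bar> \<le> 4 * (t - s)"
proof (cases "s = t")
  case False
  then have "s < t" using st by simp
  moreover have "continuous_on {s..t} (\<lambda>t. dev t e)"
    using st by (intro continuous_on_subset[OF dev_continuous[OF e]]) auto
  moreover have "(\<lambda>t. dev t e) differentiable (at \<tau>)" if "s < \<tau>" "\<tau> < t" for \<tau>
    using dev_derivative[OF e, of \<tau>] that st real_differentiable_def by fastforce
  ultimately obtain l z where z: "s < z" "z < t"
      "((\<lambda>t. dev t e) has_real_derivative l) (at z)" "dev t e - dev s e = (t - s) * l"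
    using MVT[of s t "\<lambda>t. dev t e"] by blast
  have "l = - 2 * (\<Sum>x\<in>e. force z x e)"
    using DERIV_unique[OF z(3) dev_derivative[OF e]] z st by simp
  then have "\<bar>l\<bar> \<le> 4" using abs_dev_derivative_le[OF e] by simp
  then show ?thesis
    using z st mult_right_mono[of "\<bar>l\<bar>" 4 "t - s"] by (simp add: abs_mult mult.commute)
qed simp

text \<open>Regrouping by vertices makes the softmax pairings appear: where all edges at
  \<open>x\<close> lie in \<open>B\<close>, the inner sum is the dissipation at \<open>x\<close>.
  The 4 is 2 from the square times 2 from the flow.\<close>

lemma energy_derivative:
  assumes B: "B \<subseteq> E" "finite B" and t: "0 < t"
  shows "((\<lambda>t. energy t B) has_real_derivative
    - 4 * (\<Sum>x\<in>\<Union>B. \<Sum>e\<in>incident E x \<inter> B. dev t e * force t x e)) (at t)"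
proof -
  have "((\<lambda>t. energy t B) has_real_derivative
      (\<Sum>e\<in>B. 2 * dev t e * (- 2 * (\<Sum>x\<in>e. force t x e)))) (at t)"
    unfolding energy_def using B(1) t
    by (auto intro!: derivative_eq_intros dev_derivative DERIV_sum)
  also have "(\<Sum>e\<in>B. 2 * dev t e * (- 2 * (\<Sum>x\<in>e. force t x e))) =
      - 4 * (\<Sum>e\<in>B. \<Sum>x\<in>{x\<in>\<Union>B. x \<in> e}. dev t e * force t x e)"
    unfolding sum_distrib_left
    by (intro sum.cong) (auto intro!: sum.cong)
  also have "(\<Sum>e\<in>B. \<Sum>x\<in>{x\<in>\<Union>B. x \<in> e}. dev t e * force t x e) =
      (\<Sum>x\<in>\<Union>B. \<Sum>e\<in>{e\<in>B. x \<in> e}. dev t e * force t x e)"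
    using B finite_Union by (intro sum.swap_restrict) auto
  also have "\<dots> = (\<Sum>x\<in>\<Union>B. \<Sum>e\<in>incident E x \<inter> B. dev t e * force t x e)"
    using B by (intro sum.cong) (auto simp: incident_def)
  finally show ?thesis .
qed

lemma sum_incident_le:
  fixes g :: "'a set \<Rightarrow> real"
  assumes B: "B \<subseteq> E" "finite B" and X: "finite X" "\<And>x. x \<in> X \<Longrightarrow> incident E x \<subseteq> B"
    and g: "\<And>e. 0 \<le> g e"
  shows "(\<Sum>x\<in>X. \<Sum>e\<in>incident E x. g e) \<le> 2 * (\<Sum>e\<in>B. g e)"
proof -
  have "(\<Sum>x\<in>X. \<Sum>e\<in>incident E x. g e) = (\<Sum>x\<in>X. \<Sum>e\<in>{e\<in>B. x \<in> e}. g e)"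
    using B X by (intro sum.cong) (auto simp: incident_def)
  also have "\<dots> = (\<Sum>e\<in>B. \<Sum>x\<in>{x\<in>X. x \<in> e}. g e)"
    using B X by (intro sum.swap_restrict)
  also have "\<dots> \<le> (\<Sum>e\<in>B. 2 * g e)"
  proof (rule sum_mono)
    fix e assume "e \<in> B"
    then have e: "e \<in> E" using B by blast
    have "card {x\<in>X. x \<in> e} \<le> 2"
      using card_mono[OF finite_edge[OF e], of "{x\<in>X. x \<in> e}"] card_edge[OF e] by auto
    then have "of_nat (card {x\<in>X. x \<in> e}) * g e \<le> 2 * g e"
      using g by (intro mult_right_mono) auto
    then show "(\<Sum>x\<in>{x\<in>X. x \<in> e}. g e) \<le> 2 * g e" by simp
  qed
  finally show ?thesis by (simp add: sum_distrib_left)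
qed

text \<open>Monotonicity concerns the full sum over the edges at a vertex; a partial sum may be
  negative. The Lipschitz bound on the softmax and Cauchy-Schwarz limit the loss.\<close>

lemma pairing_lower_bound:
  assumes J: "J \<subseteq> incident E x"
  shows "- (\<Sum>e\<in>J. dev t e * force t x e) \<le> 2 * D * energy t (incident E x)"
proof -
  define I where "I = incident E x"
  define S where "S = (\<Sum>e\<in>I. \<bar>dev t e\<bar>)"
  have fin: "finite I" unfolding I_def by (rule finite_incident)
  have "- (\<Sum>e\<in>J. dev t e * force t x e) \<le> (\<Sum>e\<in>J. \<bar>dev t e\<bar> * \<bar>force t x e\<bar>)"
    unfolding sum_negf[symmetric] by (intro sum_mono) (simp flip: abs_mult)
  also have "\<dots> \<le> (\<Sum>e\<in>I. \<bar>dev t e\<bar> * \<bar>force t x e\<bar>)"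
    using J fin by (intro sum_mono2) (auto simp: I_def)
  also have "\<dots> \<le> (\<Sum>e\<in>I. \<bar>dev t e\<bar> * (2 * S))"
    unfolding S_def force_def dev_def I_def
    by (intro sum_mono mult_left_mono gibbs_diff_le finite_incident) auto
  also have "\<dots> = 2 * S\<^sup>2"
    by (simp add: S_def power2_eq_square sum_distrib_left sum_distrib_right mult_ac)
  also have "S\<^sup>2 \<le> real (card I) * energy t I"
    using sum_squared_le_sum_of_squares[of "\<lambda>e. \<bar>dev t e\<bar>" I]
    by (simp add: S_def energy_def mult.commute)
  also have "\<dots> \<le> D * energy t I"
    using card_incident[of x] energy_nonneg by (intro mult_right_mono) (auto simp: I_def)
  finally show ?thesis by (simp add: I_def)
qed

text \<open>
  Only the vertices of \<open>C\<close> with an edge outside \<open>C\<close> can contribute positively, and they lie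
  outside \<open>\<Union>B\<close>, so that their contribution is paid by the shell between \<open>B\<close> and \<open>nbhd C\<close>.
\<close>

lemma energy_rate:
  assumes C: "C \<subseteq> E" "finite C" and BC: "B \<subseteq> E" "nbhd B \<subseteq> C" and Y: "Y \<subseteq> \<Union>B"
  shows "- 4 * (\<Sum>x\<in>\<Union>C. \<Sum>e\<in>incident E x \<inter> C. dev t e * force t x e)
    \<le> - 4 * (\<Sum>x\<in>Y. dissipation t x) + 16 * D * (energy t (nbhd C) - energy t B)"
proof -
  define p where "p x = (\<Sum>e\<in>incident E x \<inter> C. dev t e * force t x e)" for x
  define X where "X = {x\<in>\<Union>C. incident E x \<subseteq> C}"
  define Z where "Z = \<Union>C - X"
  have fin: "finite (\<Union>C)" using finite_Union C by simp
  have sub: "B \<subseteq> C" using subset_nbhd[of B] BC C by auto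
  have "Y \<subseteq> X"
    using Y BC sub unfolding X_def nbhd_def by blast
  then have "(\<Sum>x\<in>Y. dissipation t x) \<le> (\<Sum>x\<in>X. dissipation t x)"
    using finite_subset[OF _ fin, of X] by (intro sum_mono2 dissipation_nonneg) (auto simp: X_def)
  also have "\<dots> = (\<Sum>x\<in>X. p x)"
    unfolding p_def dissipation_def by (intro sum.cong) (auto simp: X_def Int_absorb2)
  finally have 1: "(\<Sum>x\<in>Y. dissipation t x) \<le> (\<Sum>x\<in>X. p x)" .
  \<comment> \<open>A vertex of \<open>\<Union>B\<close> has all its edges in \<open>nbhd B\<close>,
    hence in \<open>C\<close>. So \<open>x\<close>, which has an edge outside \<open>C\<close>,
    touches no edge of \<open>B\<close>.\<close>
  have shell: "incident E x \<subseteq> nbhd C - B" if "x \<in> Z" for x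
    using that BC unfolding X_def Z_def nbhd_def incident_def by blast
  have "- (\<Sum>x\<in>Z. p x) \<le> (\<Sum>x\<in>Z. 2 * D * energy t (incident E x))"
    unfolding sum_negf[symmetric]
    using pairing_lower_bound[of "incident E x \<inter> C" x t for x]
    by (intro sum_mono) (simp add: p_def)
  also have "\<dots> = 2 * D * (\<Sum>x\<in>Z. \<Sum>e\<in>incident E x. (dev t e)\<^sup>2)"
    by (simp add: energy_def sum_distrib_left)
  also have "\<dots> \<le> 2 * D * (2 * (\<Sum>e\<in>nbhd C - B. (dev t e)\<^sup>2))"
    using fin shell finite_nbhd[OF C] nbhd_subset[of C]
    by (intro mult_left_mono sum_incident_le) (auto simp: Z_def)
  also have "(\<Sum>e\<in>nbhd C - B. (dev t e)\<^sup>2) = energy t (nbhd C) - energy t B"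
    unfolding energy_def using finite_nbhd[OF C] subset_nbhd[of C] C sub
    by (intro sum_diff) auto
  \<comment> \<open>The 4 is 2 from the pairing bound times 2 for the endpoints of each edge; the
    factor 4 of the energy derivative makes it 16.\<close>
  finally have 2: "- (\<Sum>x\<in>Z. p x) \<le> 4 * D * (energy t (nbhd C) - energy t B)"
    by (simp add: algebra_simps)
  have "(\<Sum>x\<in>\<Union>C. p x) = (\<Sum>x\<in>X. p x) + (\<Sum>x\<in>Z. p x)"
    unfolding Z_def using fin by (subst sum.subset_diff[of X]) (auto simp: X_def)
  then show ?thesis using 1 2 by (simp add: p_def)
qed


section \<open>Energy bounds over all edges\<close>

lemma energy_le_nonneg: "energy_le t A \<Longrightarrow> 0 \<le> A"
  unfolding energy_le_def by (drule spec[of _ "{}"]) (simp add: energy_def)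

lemma abs_dev_le_sqrt:
  assumes "energy_le t A" "e \<in> E"
  shows "\<bar>dev t e\<bar> \<le> sqrt A"
proof -
  have "energy t {e} \<le> A" using assms unfolding energy_le_def by simp
  then show ?thesis by (simp add: energy_def real_le_rsqrt)
qed

text \<open>
  The flow moves every value at bounded speed, which gives a crude bound on the energy of the
  \<open>k\<close>-fold neighbourhood, growing exponentially in \<open>k\<close>; iterating the differential inequality
  \<open>k\<close> times gains a factor \<open>1 / k!\<close>.
\<close>

lemma energy_growth:
  fixes s t :: real
  assumes s: "0 \<le> s" "s \<le> t" and A: "energy_le s A" and B: "B \<subseteq> E" "finite B"
  shows "energy t B \<le> A * exp (16 * D * (t - s))"
proof -
  define C where "C = 16 * real D"
  define K where "K = 2 * D * C"
  \<comment> \<open>Bounds every squared deviation on \<open>[s, t]\<close>: at most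
    \<open>sqrt A\<close> in size at time \<open>s\<close>, followed by drift of speed at most
    4.\<close>
  define M where "M = (sqrt A + 4 * (t - s))\<^sup>2"
  have nn: "0 \<le> C" "0 \<le> K" "0 \<le> M" by (auto simp: C_def K_def M_def)
  have dev_le: "(dev \<tau> e)\<^sup>2 \<le> M" if "s \<le> \<tau>" "\<tau> \<le> t" "e \<in> E" for \<tau> e
  proof -
    have "\<bar>dev \<tau> e\<bar> \<le> sqrt A + 4 * (t - s)"
      using abs_dev_le_sqrt[OF A that(3)] dev_lipschitz[OF that(3) s(1) that(1)] that(2)
        abs_triangle_ineq[of "dev s e" "dev \<tau> e - dev s e"] by simp
    then show ?thesis unfolding M_def by (simp add: abs_le_square_iff[symmetric])
  qed
  have iterate: "energy \<tau> B \<le> A * exp (C * (\<tau> - s)) + M * card B * ((K * (\<tau> - s)) ^ k / fact k)"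
    if "s \<le> \<tau>" "\<tau> \<le> t" "B \<subseteq> E" "finite B" for \<tau> B k
    using that
  proof (induction k arbitrary: \<tau> B)
    case 0
    have "energy \<tau> B \<le> of_nat (card B) * M"
      unfolding energy_def using 0 dev_le by (intro sum_bounded_above) auto
    moreover have "0 \<le> A * exp (C * (\<tau> - s))" using energy_le_nonneg[OF A] by simp
    ultimately show ?case by (simp add: mult.commute)
  next
    case (Suc k)
    define P where "P x = (K * (x - s)) ^ k / fact k" for x
    \<comment> \<open>Starts at \<open>A\<close> when \<open>x = s\<close>, and its derivative is
      \<open>C\<close> times the inductive bound for \<open>nbhd B\<close>, with
      \<open>card (nbhd B)\<close> replaced by \<open>2 * D * card B\<close>.\<close>
    define h where "h x = A * exp (C * (x - s)) + M * card B * ((K * (x - s)) ^ Suc k / fact (Suc k))" for x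
    have P: "((\<lambda>x. (K * (x - s)) ^ Suc k / fact (Suc k)) has_real_derivative K * P x) (at x)" for x
    proof -
      have "((\<lambda>x. (K * (x - s)) ^ Suc k) has_real_derivative
          real (Suc k) * (K * (K * (x - s)) ^ k)) (at x)"
        by (rule derivative_eq_intros refl)+ simp
      from DERIV_cdivide[OF this, of "fact (Suc k)"] show ?thesis
        by (simp add: P_def del: of_nat_Suc power_Suc)
    qed
    have h: "(h has_real_derivative C * A * exp (C * (x - s)) + M * card B * (K * P x)) (at x)" for x
      unfolding h_def
      by (intro DERIV_add DERIV_cmult P) (auto intro!: derivative_eq_intros)
    have "energy \<tau> B - energy s B \<le> h \<tau> - h s"
    proof (rule increment_le_of_derivative_le)
      show "continuous_on {s..\<tau>} (\<lambda>\<tau>. energy \<tau> B)"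
        using s Suc.prems by (intro continuous_on_subset[OF energy_continuous]) auto
      show "continuous_on {s..\<tau>} h"
        unfolding h_def by (intro continuous_intros) auto
      fix x assume x: "s < x" "x < \<tau>"
      show "((\<lambda>\<tau>. energy \<tau> B) has_real_derivative
          - 4 * (\<Sum>v\<in>\<Union>B. \<Sum>e\<in>incident E v \<inter> B. dev x e * force x v e)) (at x)"
        using Suc.prems s x by (intro energy_derivative) auto
      show "(h has_real_derivative C * A * exp (C * (x - s)) + M * card B * (K * P x)) (at x)"
        by (rule h)
      have "energy x (nbhd B) \<le> A * exp (C * (x - s)) + M * card (nbhd B) * P x"
        unfolding P_def using Suc.prems x by (intro Suc.IH nbhd_subset finite_nbhd) auto
      also have "M * card (nbhd B) * P x \<le> M * (2 * D * card B) * P x"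
        using card_nbhd[of B] Suc.prems x nn
        by (intro mult_right_mono mult_left_mono) (auto simp: P_def simp flip: of_nat_mult)
      finally have "C * energy x (nbhd B) \<le> C * (A * exp (C * (x - s)) + M * (2 * D * card B) * P x)"
        using nn by (simp add: mult_left_mono)
      \<comment> \<open>With an empty inner set the shell is all of \<open>nbhd B\<close>, and no
        dissipation is retained.\<close>
      moreover have "- 4 * (\<Sum>v\<in>\<Union>B. \<Sum>e\<in>incident E v \<inter> B. dev x e * force x v e)
          \<le> C * energy x (nbhd B)"
        using energy_rate[of B "{}" "{}" x] Suc.prems by (simp add: C_def energy_def nbhd_def)
      ultimately show "- 4 * (\<Sum>v\<in>\<Union>B. \<Sum>e\<in>incident E v \<inter> B. dev x e * force x v e)
          \<le> C * A * exp (C * (x - s)) + M * card B * (K * P x)"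
        by (simp add: K_def algebra_simps)
    qed (use Suc.prems in auto)
    moreover have "energy s B \<le> h s"
      using A Suc.prems by (simp add: h_def energy_le_def)
    ultimately show ?case by (simp add: h_def)
  qed
  have "(\<lambda>k. (K * (t - s)) ^ k / fact k) \<longlonglongrightarrow> 0"
    using summable_LIMSEQ_zero[OF summable_exp[of "K * (t - s)"]] by (simp add: field_simps)
  then have "(\<lambda>k. A * exp (C * (t - s)) + M * card B * ((K * (t - s)) ^ k / fact k))
      \<longlonglongrightarrow> A * exp (C * (t - s)) + M * card B * 0"
    by (intro tendsto_intros)
  then have "energy t B \<le> A * exp (C * (t - s)) + M * card B * 0"
    by (rule LIMSEQ_le_const) (use iterate[of t B] s B in auto)
  then show ?thesis by (simp add: C_def)
qed

text \<open>
  Averaging over \<open>N\<close> nested neighbourhoods makes the shell terms telescope, and they disappear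
  as \<open>N\<close> tends to infinity.
\<close>

lemma energy_le_decrease:
  assumes s: "0 \<le> s" "s \<le> t" and A: "energy_le s A" and Y: "finite Y" "Y \<subseteq> \<Union>E"
    and \<delta>: "\<And>\<tau>. s < \<tau> \<Longrightarrow> \<tau> < t \<Longrightarrow> \<delta> \<le> (\<Sum>x\<in>Y. dissipation \<tau> x)"
  shows "energy_le t (A - 4 * \<delta> * (t - s))"
  unfolding energy_le_def
proof (intro allI impI)
  fix F assume F: "F \<subseteq> E" "finite F"
  \<comment> \<open>Starting from \<open>F\<close> and the edges at \<open>Y\<close> ensures that
    every stage contains \<open>F\<close> and sees the dissipation on \<open>Y\<close>.\<close>
  define B where "B n = (nbhd ^^ n) (F \<union> (\<Union>x\<in>Y. incident E x))" for n
  have BSuc: "B (Suc n) = nbhd (B n)" for n by (simp add: B_def)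
  have B: "B n \<subseteq> E \<and> finite (B n)" for n
  proof (induction n)
    case 0
    then show ?case using F Y finite_incident by (auto simp: B_def incident_def)
  next
    case (Suc n)
    then show ?case using nbhd_subset[of "B n"] finite_nbhd[of "B n"] by (simp add: BSuc)
  qed
  have inc: "B n \<subseteq> B (Suc n)" for n
    using subset_nbhd[of "B n"] B[of n] by (simp add: BSuc)
  have B0: "B 0 \<subseteq> B n" for n
    by (induction n) (use inc in blast)+
  have YB: "Y \<subseteq> \<Union>(B n)" for n
  proof -
    have "Y \<subseteq> \<Union>(B 0)" using Y by (auto simp: B_def incident_def)
    then show ?thesis using B0[of n] by blast
  qed
  define C where "C = 16 * real D"
  \<comment> \<open>A bound for the energy of every \<open>B n\<close> throughout
    \<open>[s, t]\<close>, uniform in \<open>n\<close>.\<close>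
  define G where "G = A * exp (C * (t - s))"
  have C0: "0 \<le> C" by (simp add: C_def)
  have growth: "energy \<tau> (B n) \<le> G" if "s \<le> \<tau>" "\<tau> \<le> t" for \<tau> n
  proof -
    have "energy \<tau> (B n) \<le> A * exp (C * (\<tau> - s))"
      using energy_growth[OF s(1) that(1) A, of "B n"] B[of n] by (simp add: C_def)
    also have "\<dots> \<le> G"
      unfolding G_def using that C0 energy_le_nonneg[OF A] by (intro mult_left_mono) (auto intro: mult_left_mono)
    finally show ?thesis .
  qed
  define g where "g n x = - 4 * (\<Sum>v\<in>\<Union>(B n). \<Sum>e\<in>incident E v \<inter> B n. dev x e * force x v e)" for n x
  have avg: "real N * energy t F \<le> real N * (A - 4 * \<delta> * (t - s)) + 2 * C * G * (t - s)" for N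
  proof -
    define L where "L = - 4 * real N * \<delta> + 2 * C * G"
    have "(\<Sum>n<N. energy t (B (Suc n))) - (\<Sum>n<N. energy s (B (Suc n))) \<le> L * t - L * s"
    proof (rule increment_le_of_derivative_le)
      show "continuous_on {s..t} (\<lambda>\<tau>. \<Sum>n<N. energy \<tau> (B (Suc n)))"
        using s B by (intro continuous_intros continuous_on_subset[OF energy_continuous]) auto
      show "continuous_on {s..t} (\<lambda>\<tau>. L * \<tau>)" by (intro continuous_intros)
      fix x assume x: "s < x" "x < t"
      show "((\<lambda>\<tau>. \<Sum>n<N. energy \<tau> (B (Suc n))) has_real_derivative (\<Sum>n<N. g (Suc n) x)) (at x)"
        unfolding g_def using B x s by (intro DERIV_sum energy_derivative) auto
      show "((\<lambda>\<tau>. L * \<tau>) has_real_derivative L) (at x)"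
        by (auto intro!: derivative_eq_intros)
      have "g (Suc n) x \<le> - 4 * \<delta> + C * (energy x (B (Suc (Suc n))) - energy x (B n))" for n
        using energy_rate[of "B (Suc n)" "B n" Y x] B[of n] B[of "Suc n"] YB[of n] \<delta>[OF x]
        by (simp add: g_def BSuc C_def)
      then have "(\<Sum>n<N. g (Suc n) x)
          \<le> (\<Sum>n<N. - 4 * \<delta> + C * (energy x (B (Suc (Suc n))) - energy x (B n)))"
        by (rule sum_mono)
      also have "\<dots> = - 4 * real N * \<delta> + C * (\<Sum>n<N. energy x (B (Suc (Suc n))) - energy x (B n))"
        by (simp add: sum_subtractf sum_distrib_left right_diff_distrib)
      \<comment> \<open>The shells advance by two stages, so telescoping leaves the last two
        energies, each at most \<open>G\<close>, minus the first two.\<close>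
      also have "(\<Sum>n<N. energy x (B (Suc (Suc n))) - energy x (B n)) =
          energy x (B (Suc N)) + energy x (B N) - energy x (B (Suc 0)) - energy x (B 0)"
        by (induction N) auto
      also have "\<dots> \<le> 2 * G"
        using growth[of x N] growth[of x "Suc N"] x
          energy_nonneg[of x "B (Suc 0)"] energy_nonneg[of x "B 0"] by simp
      finally show "(\<Sum>n<N. g (Suc n) x) \<le> L"
        using C0 by (simp add: L_def mult_left_mono mult.assoc mult.left_commute)
    qed (use s in auto)
    moreover have "(\<Sum>n<N. energy s (B (Suc n))) \<le> of_nat (card {..<N}) * A"
      using A B by (intro sum_bounded_above) (auto simp: energy_le_def)
    moreover have "of_nat (card {..<N}) * energy t F \<le> (\<Sum>n<N. energy t (B (Suc n)))"
    proof (rule sum_bounded_below)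
      fix n
      have "F \<subseteq> B (Suc n)" using B0[of "Suc n"] by (auto simp: B_def)
      then show "energy t F \<le> energy t (B (Suc n))" using B by (intro energy_mono) auto
    qed
    ultimately show ?thesis by (simp add: L_def algebra_simps)
  qed
  show "energy t F \<le> A - 4 * \<delta> * (t - s)"
  proof (rule ccontr)
    assume "\<not> ?thesis"
    then have "0 < energy t F - (A - 4 * \<delta> * (t - s))" by simp
    then obtain N :: nat where "2 * C * G * (t - s) < real N * (energy t F - (A - 4 * \<delta> * (t - s)))"
      using reals_Archimedean3 by blast
    then show False using avg[of N] by (simp add: algebra_simps)
  qed
qed

lemma energy_le_antimono:
  assumes "0 \<le> s" "s \<le> t" "energy_le s A"
  shows "energy_le t A"
  using energy_le_decrease[of s t A "{}" 0] assms by simp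

subsection \<open>Convergence\<close>

text \<open>A gap recurring at arbitrarily late times persists for a fixed duration by the Lipschitz
  bound. Each recurrence then lowers the energy bound by a fixed amount, which cannot go on forever
  since the bound stays nonnegative.\<close>

lemma dev_diff_tendsto_0:
  assumes A: "energy_le 0 A" and ab: "a \<in> incident E x" "b \<in> incident E x"
  shows "((\<lambda>t. dev t a - dev t b) \<longlongrightarrow> 0) at_top"
proof (rule ccontr)
  assume "\<not> ?thesis"
  then obtain \<epsilon> where \<epsilon>: "0 < \<epsilon>" and
      large: "\<And>N. \<exists>t\<ge>N. \<epsilon> \<le> \<bar>dev t a - dev t b\<bar>"
    unfolding tendsto_iff eventually_at_top_linorder by (auto simp: not_less)
  define \<gamma> where "\<gamma> = gibbs (incident E x) rs a * gibbs (incident E x) rs b * exp (- 2 * sqrt A) / 2"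
  have \<gamma>: "0 < \<gamma>"
    using gibbs_pos[OF finite_incident ab(1)] gibbs_pos[OF finite_incident ab(2)]
    by (simp add: \<gamma>_def)
  have diss: "\<gamma> * (dev t a - dev t b)\<^sup>2 \<le> dissipation t x" if "0 \<le> t" for t
  proof -
    have "\<bar>dev t c\<bar> \<le> sqrt A" if "c \<in> incident E x" for c
      using abs_dev_le_sqrt[OF energy_le_antimono[OF _ \<open>0 \<le> t\<close> A]] that
      by (simp add: incident_def)
    then show ?thesis
      unfolding \<gamma>_def dissipation_def force_def dev_def
      by (intro gibbs_pairing_ge[OF finite_incident ab])
  qed
  \<comment> \<open>Within time \<open>h\<close> each of the two deviations moves by at most
    \<open>4 * h\<close>, so at least half of the gap \<open>\<epsilon>\<close> survives.\<close>
  define h where "h = \<epsilon> / 16"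
  define \<delta> where "\<delta> = \<gamma> * (\<epsilon> / 2)\<^sup>2"
  have pos: "0 < h" "0 < \<delta>" using \<epsilon> \<gamma> by (auto simp: h_def \<delta>_def)
  have drop: "\<exists>s'\<ge>0. energy_le s' (A' - 4 * \<delta> * h)" if s: "0 \<le> s" "energy_le s A'" for s A'
  proof -
    obtain t where t: "s \<le> t" "\<epsilon> \<le> \<bar>dev t a - dev t b\<bar>" using large by blast
    have "\<delta> \<le> (\<Sum>y\<in>{x}. dissipation \<tau> y)" if \<tau>: "t < \<tau>" "\<tau> < t + h" for \<tau>
    proof -
      have "\<bar>dev \<tau> c - dev t c\<bar> \<le> 4 * h" if "c \<in> incident E x" for c
        using dev_lipschitz[of c t \<tau>] that \<tau> s t by (simp add: incident_def)
      from this[OF ab(1)] this[OF ab(2)] have "\<epsilon> / 2 \<le> \<bar>dev \<tau> a - dev \<tau> b\<bar>"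
        using t(2) unfolding h_def by linarith
      then have "(\<epsilon> / 2)\<^sup>2 \<le> (dev \<tau> a - dev \<tau> b)\<^sup>2"
        using \<epsilon> power_mono[of "\<epsilon> / 2" "\<bar>dev \<tau> a - dev \<tau> b\<bar>" 2] by simp
      then have "\<delta> \<le> \<gamma> * (dev \<tau> a - dev \<tau> b)\<^sup>2"
        unfolding \<delta>_def using \<gamma> by (intro mult_left_mono) auto
      also have "\<dots> \<le> dissipation \<tau> x" using diss \<tau> s t by simp
      finally show ?thesis by simp
    qed
    then have "energy_le (t + h) (A' - 4 * \<delta> * (t + h - t))"
      using s t pos ab energy_le_antimono[OF s(1) t(1) s(2)]
      by (intro energy_le_decrease[where Y = "{x}"]) (auto simp: incident_def)
    then show ?thesis using s t pos by (intro exI[of _ "t + h"]) auto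
  qed
  have "\<exists>s\<ge>0. energy_le s (A - real k * (4 * \<delta> * h))" for k
  proof (induction k)
    case 0
    then show ?case using A by auto
  next
    case (Suc k)
    then show ?case using drop by (fastforce simp: algebra_simps)
  qed
  then have "real k * (4 * \<delta> * h) \<le> A" for k
    using energy_le_nonneg by fastforce
  moreover obtain k :: nat where "A < real k * (4 * \<delta> * h)"
    using reals_Archimedean3[of "4 * \<delta> * h"] pos by auto
  ultimately show False by (simp add: not_less[symmetric])
qed

text \<open>Smallness of the differences is needed on finitely many edges only, so no uniformity
  over \<open>E\<close> is required.\<close>

lemma dev_tendsto_0:
  assumes A: "energy_le 0 A" and inf: "infinite E" and e: "e \<in> E"
    and diff: "\<And>e'. e' \<in> E \<Longrightarrow> ((\<lambda>t. dev t e - dev t e') \<longlongrightarrow> 0) at_top"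
  shows "((\<lambda>t. dev t e) \<longlongrightarrow> 0) at_top"
  unfolding tendsto_iff
proof (intro allI impI)
  fix \<epsilon> :: real assume \<epsilon>: "0 < \<epsilon>"
  \<comment> \<open>Chosen so that \<open>n\<close> edges with deviations of size at least
    \<open>\<epsilon> / 2\<close> would carry more energy than \<open>A\<close>.\<close>
  then obtain n :: nat where n: "A < real n * (\<epsilon> / 2)\<^sup>2"
    using reals_Archimedean3[of "(\<epsilon> / 2)\<^sup>2"] by auto
  obtain F where F: "finite F" "card F = n" "F \<subseteq> E"
    using infinite_arbitrarily_large[OF inf] by blast
  have "\<forall>\<^sub>F t in at_top. \<forall>e'\<in>F. \<bar>dev t e - dev t e'\<bar> < \<epsilon> / 2"
  proof (intro eventually_ball_finite ballI F(1))
    fix e' assume "e' \<in> F"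
    then show "\<forall>\<^sub>F t in at_top. \<bar>dev t e - dev t e'\<bar> < \<epsilon> / 2"
      using tendstoD[OF diff, of e' "\<epsilon> / 2"] \<epsilon> F(3) by (auto simp: dist_real_def)
  qed
  moreover have "\<forall>\<^sub>F t in at_top. (0::real) \<le> t" by (rule eventually_ge_at_top)
  ultimately show "\<forall>\<^sub>F t in at_top. dist (dev t e) 0 < \<epsilon>"
  proof eventually_elim
    case (elim t)
    show ?case
    proof (rule ccontr)
      assume "\<not> ?case"
      then have *: "\<epsilon> \<le> \<bar>dev t e\<bar>" by (simp add: dist_real_def)
      have "of_nat (card F) * (\<epsilon> / 2)\<^sup>2 \<le> energy t F"
        unfolding energy_def
      proof (rule sum_bounded_below)
        fix e' assume "e' \<in> F"
        with elim(1) have "\<bar>dev t e - dev t e'\<bar> < \<epsilon> / 2" by blast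
        with * have "\<epsilon> / 2 \<le> \<bar>dev t e'\<bar>" by linarith
        then show "(\<epsilon> / 2)\<^sup>2 \<le> (dev t e')\<^sup>2"
          using \<epsilon> power_mono[of "\<epsilon> / 2" "\<bar>dev t e'\<bar>" 2] by simp
      qed
      also have "energy t F \<le> A"
        using energy_le_antimono[OF _ elim(2) A] F by (simp add: energy_le_def)
      finally show False using n F by simp
    qed
  qed
qed

end

section \<open>From the graph to the dynamics on edges\<close>

lemma bij_betw_neighbours_incident:
  assumes "\<forall>e\<in>E. card e = 2"
  shows "bij_betw (\<lambda>u. {x, u}) (neighbours E x) (incident E x)"
  unfolding bij_betw_def
proof
  show "inj_on (\<lambda>u. {x, u}) (neighbours E x)"
    by (auto simp: inj_on_def doubleton_eq_iff)
  show "(\<lambda>u. {x, u}) ` neighbours E x = incident E x"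
  proof
    show "(\<lambda>u. {x, u}) ` neighbours E x \<subseteq> incident E x"
      by (auto simp: neighbours_def incident_def)
    show "incident E x \<subseteq> (\<lambda>u. {x, u}) ` neighbours E x"
    proof
      fix e assume "e \<in> incident E x"
      then have e: "e \<in> E" "x \<in> e" by (auto simp: incident_def)
      with assms obtain u where "e = {x, u}"
        by (metis card_2_iff doubleton_eq_iff insertE singletonD)
      with e show "e \<in> (\<lambda>u. {x, u}) ` neighbours E x" by (auto simp: neighbours_def)
    qed
  qed
qed

lemma LLY_curvature_gibbs:
  assumes "\<forall>e\<in>E. card e = 2"
  shows "LLY_curvature E r e = 2 * (\<Sum>x\<in>e. gibbs (incident E x) r e) - 2"
  unfolding LLY_curvature_def vertex_weight_def gibbs_def
  by (simp add: sum.reindex_bij_betw[OF bij_betw_neighbours_incident[OF assms], of "\<lambda>e. exp (r e)"])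

text \<open>A path from \<open>x\<close> to some other vertex begins with an edge at
  \<open>x\<close>. Together with two-element edges this forces \<open>E\<close> to be
  infinite.\<close>

lemma connected_graph_covered:
  assumes "connected_graph V E" "infinite V"
  shows "V \<subseteq> \<Union>E"
proof
  fix x assume x: "x \<in> V"
  have "infinite (V - {x})" using assms by simp
  then obtain y where "y \<in> V" "y \<noteq> x" by (metis Diff_iff finite.emptyI insertI1 all_not_in_conv)
  with assms(1) x have "(x, y) \<in> {(u, v). {u, v} \<in> E}\<^sup>*"
    by (auto simp: connected_graph_def)
  then show "x \<in> \<Union>E"
    using \<open>y \<noteq> x\<close> by (cases rule: converse_rtranclE) auto
qed

theorem theorem1p4:
  fixes V :: "'a set" and E :: "'a set set"
    and rs \<kappa>s r0 :: "'a set \<Rightarrow> real"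
    and r :: "real \<Rightarrow> 'a set \<Rightarrow> real"
  assumes "simple_graph V E"
    and "infinite V"
    and "connected_graph V E"
    and "locally_finite_graph V E"
    and "girth E \<ge> 6"
    and "bdd_above (degree E ` V)"
    and "rs \<in> ell_infinity E"
    and "\<forall>e\<in>E. LLY_curvature E rs e = \<kappa>s e"
    and "(\<lambda>e. r0 e - rs e) \<in> ell2 E"
    and "sup_norm E (\<lambda>e. r0 e - rs e)
           \<le> 3 * sqrt 3 * min 1 ((real (max_degree V E) * exp (2 * sup_norm E rs)) powi (-2))"
    and "ricci_flow_solution E \<kappa>s r0 r"
  shows "(\<forall>e\<in>E. ((\<lambda>t. r t e) \<longlongrightarrow> rs e) at_top) \<and>
         (\<forall>e\<in>E. ((\<lambda>t. LLY_curvature E (r t) e) \<longlongrightarrow> \<kappa>s e) at_top)"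
proof -
  have card2: "\<forall>e\<in>E. card e = 2" and EV: "\<And>e. e \<in> E \<Longrightarrow> e \<subseteq> V"
    using assms(1) by (auto simp: simple_graph_def)
  obtain D where D: "\<And>x. x \<in> V \<Longrightarrow> degree E x \<le> D"
    using assms(6) by (auto simp: bdd_above_def)
  note bij = bij_betw_neighbours_incident[OF card2]
  note LLY = LLY_curvature_gibbs[OF card2]
  have incident_V: "finite (incident E x) \<and> card (incident E x) \<le> D" for x
  proof (cases "x \<in> V")
    case True
    then show ?thesis
      using assms(4) D[OF True] bij_betw_finite[OF bij] bij_betw_same_card[OF bij]
      by (simp add: locally_finite_graph_def degree_def)
  next
    case False
    then have "incident E x = {}" using EV by (auto simp: incident_def)
    then show ?thesis by simp
  qed
  interpret bounded_degree_flow E D rs r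
  proof
    fix e t assume e: "e \<in> E" and t: "(0::real) < t"
    have "((\<lambda>t. r t e) has_real_derivative - LLY_curvature E (r t) e + LLY_curvature E rs e) (at t)"
      using assms(8,11) e t by (simp add: ricci_flow_solution_def)
    then show "((\<lambda>t. r t e) has_real_derivative
        - 2 * (\<Sum>x\<in>e. gibbs (incident E x) (r t) e - gibbs (incident E x) rs e)) (at t)"
      by (simp add: LLY sum_subtractf algebra_simps)
  qed (use card2 incident_V assms(11) in \<open>auto simp: ricci_flow_solution_def\<close>)
  have dev0: "dev 0 e = r0 e - rs e" if "e \<in> E" for e
    using assms(11) that by (simp add: dev_def ricci_flow_solution_def)
  define A where "A = infsum (\<lambda>e. \<bar>r0 e - rs e\<bar>\<^sup>2) E"
  have A: "energy_le 0 A"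
    unfolding energy_le_def
  proof (intro allI impI)
    fix F assume F: "F \<subseteq> E" "finite F"
    have "energy 0 F = (\<Sum>e\<in>F. \<bar>r0 e - rs e\<bar>\<^sup>2)"
      unfolding energy_def using F dev0 by (intro sum.cong) auto
    also have "\<dots> \<le> A"
      unfolding A_def using assms(9) F by (intro finite_sum_le_infsum) (auto simp: ell2_def)
    finally show "energy 0 F \<le> A" .
  qed
  have "infinite E"
  proof
    assume "finite E"
    then have "finite (\<Union>E)" by (rule finite_Union[OF order_refl])
    then show False
      using connected_graph_covered[OF assms(3,2)] assms(2) finite_subset by blast
  qed
  \<comment> \<open>Induction along a path from \<open>x\<close>: the edge \<open>{y, z}\<close> is
    incident to both its ends, so it links the claim at \<open>y\<close> to the edges at
    \<open>z\<close>.\<close>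
  have path: "\<forall>a\<in>incident E x. \<forall>b\<in>incident E y. ((\<lambda>t. dev t a - dev t b) \<longlongrightarrow> 0) at_top"
    if "(x, y) \<in> {(u, v). {u, v} \<in> E}\<^sup>*" for x y
    using that
  proof (induction rule: rtrancl_induct)
    case base
    then show ?case using dev_diff_tendsto_0[OF A] by blast
  next
    case (step y z)
    show ?case
    proof (intro ballI)
      fix a b assume ab: "a \<in> incident E x" "b \<in> incident E z"
      have c: "{y, z} \<in> incident E y" "{y, z} \<in> incident E z"
        using step.hyps by (auto simp: incident_def)
      have "((\<lambda>t. (dev t a - dev t {y, z}) + (dev t {y, z} - dev t b)) \<longlongrightarrow> 0 + 0) at_top"
        using step.IH ab(1) c(1) by (intro tendsto_add dev_diff_tendsto_0[OF A c(2) ab(2)]) blast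
      then show "((\<lambda>t. dev t a - dev t b) \<longlongrightarrow> 0) at_top" by simp
    qed
  qed
  have conv: "((\<lambda>t. r t e) \<longlongrightarrow> rs e) at_top" if e: "e \<in> E" for e
  proof -
    have "((\<lambda>t. dev t e) \<longlongrightarrow> 0) at_top"
    proof (rule dev_tendsto_0[OF A \<open>infinite E\<close> e])
      fix e' assume e': "e' \<in> E"
      obtain x y where "x \<in> e" "y \<in> e'"
        using card2 e e' by (metis all_not_in_conv card.empty zero_neq_numeral)
      moreover from this have "(x, y) \<in> {(u, v). {u, v} \<in> E}\<^sup>*"
        using assms(3) EV e e' by (auto simp: connected_graph_def)
      ultimately show "((\<lambda>t. dev t e - dev t e') \<longlongrightarrow> 0) at_top"
        using path e e' by (simp add: incident_def)
    qed
    then show ?thesis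
      unfolding dev_def by (simp add: LIM_zero_iff)
  qed
  have "((\<lambda>t. LLY_curvature E (r t) e) \<longlongrightarrow> \<kappa>s e) at_top" if e: "e \<in> E" for e
  proof -
    have "((\<lambda>t. LLY_curvature E (r t) e) \<longlongrightarrow> LLY_curvature E rs e) at_top"
      \<comment> \<open>The curvature of \<open>e\<close> depends continuously on finitely many edge
        values, since the limiting denominators are positive.\<close>
      unfolding LLY gibbs_def
    proof (intro tendsto_intros conv e)
      fix x b assume "x \<in> e"
      then have "e \<in> incident E x" using e by (simp add: incident_def)
      then show "(\<Sum>b\<in>incident E x. exp (rs b)) \<noteq> 0"
        using sum_exp_pos[OF finite_incident, of e x rs] by simp
    qed (simp add: incident_def)
    then show ?thesis using assms(8) e by simp
  qed
  with conv show ?thesis by blast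
qed

end
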